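(* Let $X=\{x,y\}$ with $x\neq y$ and $E=\{e_1,e_2\}$ with $e_1\neq e_2$. If $(X,\mathcal{T},E)$ is a soft $T_1$-II space over $X$, then it is a soft $T_2$-I space.
   Context: Let $X$ be a universe set and $E$ a set of parameters. A soft set $(F,E)$ over $X$ is a mapping $F:E\to\mathcal{P}(X)$. Unions and intersections of soft sets are taken parameterwise: $(F\cup G)(e)=F(e)\cup G(e)$, $(F\cap G)(e)=F(e)\cap G(e)$, and similarly for arbitrary families. $\widetilde{\emptyset}$ and $\widetilde{X}$ denote the soft sets with constant value $\emptyset$ and $X$, respectively. A soft topology on $X$ (with parameter set $E$) is a collection $\mathcal{T}$ of soft sets $(F,E)$ over $X$ which contains $\widetilde{\emptyset}$ and $\widetilde{X}$ and is closed under arbitrary unions and under intersections of two members; $(X,\mathcal{T},E)$ is then called a soft topological space, and members of $\mathcal{T}$ are called soft open sets. For $x\in X$, write $x\,\widehat{\in}\,(F,E)$ if $x\in F(e)$ for all $e\in E$. For $a\in E$ and $x\in X$, the soft point $P_a^x$ is the soft set with value $\{x\}$ at $a$ and value $\emptyset$ at every other parameter. Write $P_a^x\,\widetilde{\in}\,(F,E)$ if $x\in F(a)$, and $P_a^x\,\widetilde{\notin}\,(F,E)$ for its negation. Two soft points $P_a^x$, $P_b^y$ are different iff $(a,x)\neq(b,y)$. $(X,\mathcal{T},E)$ is a soft $T_1$-II space if for all soft points $P_a^x\neq P_b^y$ there are soft open sets $(F,E)$ and $(G,E)$ with $P_a^x\,\widetilde{\in}\,(F,E)$, $P_b^y\,\widetilde{\notin}\,(F,E)$,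 $P_b^y\,\widetilde{\in}\,(G,E)$ and $P_a^x\,\widetilde{\notin}\,(G,E)$. $(X,\mathcal{T},E)$ is a soft $T_2$-I space if for all $x,y\in X$ with $x\neq y$ there are soft open sets $(F,E)$ and $(G,E)$ with $x\,\widehat{\in}\,(F,E)$, $y\,\widehat{\in}\,(G,E)$ and $(F,E)\cap(G,E)=\widetilde{\emptyset}$. *)

theory Defs
  imports Main "HOL-Library.FuncSet"
begin

(* A soft set over X with parameter set E is an extensional function on E, so that HOL
   equality of two soft sets is agreement at the parameters in E. *)

type_synonym ('e, 'x) soft_set = "'e \<Rightarrow> 'x set"

definition soft_sets :: "'x set \<Rightarrow> 'e set \<Rightarrow> ('e, 'x) soft_set set" where
  "soft_sets X E = E \<rightarrow>\<^sub>E Pow X"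

definition soft_null :: "'e set \<Rightarrow> ('e, 'x) soft_set" where
  "soft_null E = (\<lambda>e\<in>E. {})"

definition soft_full :: "'x set \<Rightarrow> 'e set \<Rightarrow> ('e, 'x) soft_set" where
  "soft_full X E = (\<lambda>e\<in>E. X)"

definition soft_Union :: "'e set \<Rightarrow> ('e, 'x) soft_set set \<Rightarrow> ('e, 'x) soft_set" where
  "soft_Union E \<F> = (\<lambda>e\<in>E. \<Union>F\<in>\<F>. F e)"

definition soft_inter :: "'e set \<Rightarrow> ('e, 'x) soft_set \<Rightarrow> ('e, 'x) soft_set \<Rightarrow> ('e, 'x) soft_set" where
  "soft_inter E F G = (\<lambda>e\<in>E. F e \<inter> G e)"

definition soft_topological_space :: "'x set \<Rightarrow> ('e, 'x) soft_set set \<Rightarrow> 'e set \<Rightarrow> bool" where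
  "soft_topological_space X \<T> E \<longleftrightarrow>
     \<T> \<subseteq> soft_sets X E \<and>
     soft_null E \<in> \<T> \<and> soft_full X E \<in> \<T> \<and>
     (\<forall>\<F>. \<F> \<subseteq> \<T> \<longrightarrow> soft_Union E \<F> \<in> \<T>) \<and>
     (\<forall>F\<in>\<T>. \<forall>G\<in>\<T>. soft_inter E F G \<in> \<T>)"

definition full_mem :: "'e set \<Rightarrow> 'x \<Rightarrow> ('e, 'x) soft_set \<Rightarrow> bool" where
  "full_mem E x F \<longleftrightarrow> (\<forall>e\<in>E. x \<in> F e)"

definition soft_point :: "'e set \<Rightarrow> 'e \<Rightarrow> 'x \<Rightarrow> ('e, 'x) soft_set" where
  "soft_point E a x = (\<lambda>e\<in>E. if e = a then {x} else {})"

(* Membership of the soft point with parameter a and element x; the soft point is passed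
   through the pair (a, x), which determines it by soft_point_eq_iff below. *)
definition soft_point_mem :: "'e \<Rightarrow> 'x \<Rightarrow> ('e, 'x) soft_set \<Rightarrow> bool" where
  "soft_point_mem a x F \<longleftrightarrow> x \<in> F a"

lemma soft_point_eq_iff:
  assumes "a \<in> E" "b \<in> E"
  shows "soft_point E a x = soft_point E b y \<longleftrightarrow> (a, x) = (b, y)"
proof
  assume "soft_point E a x = soft_point E b y"
  then have "soft_point E a x a = soft_point E b y a" by simp
  with assms show "(a, x) = (b, y)"
    by (simp add: soft_point_def split: if_splits)
qed simp

definition soft_T1_II :: "'x set \<Rightarrow> ('e, 'x) soft_set set \<Rightarrow> 'e set \<Rightarrow> bool" where
  "soft_T1_II X \<T> E \<longleftrightarrow>
     soft_topological_space X \<T> E \<and>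
     (\<forall>a\<in>E. \<forall>b\<in>E. \<forall>x\<in>X. \<forall>y\<in>X. soft_point E a x \<noteq> soft_point E b y \<longrightarrow>
        (\<exists>F\<in>\<T>. \<exists>G\<in>\<T>.
           soft_point_mem a x F \<and> \<not> soft_point_mem b y F \<and>
           soft_point_mem b y G \<and> \<not> soft_point_mem a x G))"

definition soft_T2_I :: "'x set \<Rightarrow> ('e, 'x) soft_set set \<Rightarrow> 'e set \<Rightarrow> bool" where
  "soft_T2_I X \<T> E \<longleftrightarrow>
     soft_topological_space X \<T> E \<and>
     (\<forall>x\<in>X. \<forall>y\<in>X. x \<noteq> y \<longrightarrow>
        (\<exists>F\<in>\<T>. \<exists>G\<in>\<T>.
           full_mem E x F \<and> full_mem E y G \<and> soft_inter E F G = soft_null E))"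

end

(* A finite soft T1-II space is discrete: intersecting finitely many separating soft open sets
   gives every soft point a soft open neighbourhood inside any soft set containing it. Hence the
   constant soft sets with values {x} and {y} are soft open, and they separate x from y. *)
theory Submission
  imports Defs
begin

lemma soft_T1_II_imp_space:
  assumes "soft_T1_II X \<T> E"
  shows "soft_topological_space X \<T> E"
  using assms by (simp only: soft_T1_II_def)

text \<open>Induction on \<open>S\<close>: each further soft point costs one more binary
  intersection with a soft open set that contains \<open>(a, u)\<close> and misses that point.
  Removing \<open>(a, u)\<close> from \<open>S\<close> makes every such separation
  available.\<close>

lemma soft_T1_II_avoid_finite:
  assumes T1: "soft_T1_II X \<T> E" and a: "a \<in> E" and u: "u \<in> X"
    and "finite S" and "S \<subseteq> E \<times> X - {(a, u)}"
  shows "\<exists>F\<in>\<T>. u \<in> F a \<and> (\<forall>(b, v)\<in>S. v \<notin> F b)"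
  using assms(4,5)
proof (induction S rule: finite_induct)
  case empty
  \<comment> \<open>With nothing to avoid, the full soft set serves as the empty
    intersection.\<close>
  have "soft_full X E \<in> \<T>"
    using soft_T1_II_imp_space[OF T1] by (simp only: soft_topological_space_def)
  then show ?case
    using a u by (intro bexI[of _ "soft_full X E"]) (auto simp: soft_full_def)
next
  case (insert p S)
  obtain b v where p: "p = (b, v)" by (cases p)
  have b: "b \<in> E" and v: "v \<in> X" and ne: "(a, u) \<noteq> (b, v)"
    using insert.prems p by auto
  obtain F where F: "F \<in> \<T>" "u \<in> F a" "\<forall>(c, w)\<in>S. w \<notin> F c"
    using insert.IH insert.prems by blast
  have "soft_point E a u \<noteq> soft_point E b v"
    using ne by (simp only: soft_point_eq_iff[OF a b] not_False_eq_True)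
  then obtain G where G: "G \<in> \<T>" "u \<in> G a" "v \<notin> G b"
    using T1[unfolded soft_T1_II_def soft_point_mem_def, THEN conjunct2,
        rule_format, OF a b u v] by blast
  have "soft_inter E F G \<in> \<T>"
    using soft_T1_II_imp_space[OF T1] F(1) G(1) unfolding soft_topological_space_def by blast
  moreover have "u \<in> soft_inter E F G a"
    using a F G by (simp add: soft_inter_def)
  \<comment> \<open>All parameters occurring in \<open>insert p S\<close> lie in \<open>E\<close>,
    where \<open>soft_inter\<close> really is the intersection; elsewhere its value is
    \<open>undefined\<close>.\<close>
  moreover have "\<forall>(c, w)\<in>insert p S. w \<notin> soft_inter E F G c"
    using F(3) G(3) p b insert.prems by (fastforce simp: soft_inter_def split: if_splits)
  ultimately show ?case by blast
qed

lemma finite_soft_T1_II_discrete: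
  assumes T1: "soft_T1_II X \<T> E" and "finite X" "finite E" and H: "H \<in> soft_sets X E"
  shows "H \<in> \<T>"
proof -
  \<comment> \<open>The union of this family is the soft interior of \<open>H\<close>; the goal is
    that it exhausts \<open>H\<close>.\<close>
  define \<F> where "\<F> = {F\<in>\<T>. \<forall>e\<in>E. F e \<subseteq> H e}"
  have HX: "H e \<subseteq> X" if "e \<in> E" for e
    using H that by (auto simp: soft_sets_def)
  have nhd: "\<exists>F\<in>\<F>. u \<in> F a" if a: "a \<in> E" and u: "u \<in> H a" for a u
  proof -
    \<comment> \<open>These are the soft points outside \<open>H\<close>. A soft set over
      \<open>X\<close> that avoids them all lies inside \<open>H\<close>.\<close>
    let ?S = "{(b, v)\<in>E \<times> X. v \<notin> H b}"
    have "finite ?S"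
      using assms by (intro finite_subset[of ?S "E \<times> X"]) auto
    then obtain F where F: "F \<in> \<T>" "u \<in> F a" "\<forall>(b, v)\<in>?S. v \<notin> F b"
      using soft_T1_II_avoid_finite[OF T1 a, of u ?S] u HX[OF a] by fastforce
    have "F \<in> soft_sets X E"
      using soft_T1_II_imp_space[OF T1] F(1) unfolding soft_topological_space_def by blast
    then have "F e \<subseteq> H e" if "e \<in> E" for e
      using F(3) that by (auto simp: soft_sets_def)
    then show ?thesis
      using F by (auto simp: \<F>_def)
  qed
  have "soft_Union E \<F> = H"
  proof
    fix e
    show "soft_Union E \<F> e = H e"
    proof (cases "e \<in> E")
      case True
      then show ?thesis
        using nhd by (auto simp: soft_Union_def \<F>_def)
    next
      \<comment> \<open>Off \<open>E\<close> both sides are \<open>undefined\<close>, since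
        \<open>H\<close> is extensional.\<close>
      case False
      then show ?thesis
        using PiE_arb[OF H[unfolded soft_sets_def] False] by (simp add: soft_Union_def)
    qed
  qed
  moreover have "soft_Union E \<F> \<in> \<T>"
    using soft_T1_II_imp_space[OF T1] by (simp add: soft_topological_space_def \<F>_def)
  ultimately show ?thesis by simp
qed

lemma finite_soft_T1_II_imp_soft_T2_I:
  assumes T1: "soft_T1_II X \<T> E" and "finite X" "finite E"
  shows "soft_T2_I X \<T> E"
  unfolding soft_T2_I_def
proof (intro conjI ballI impI)
  show "soft_topological_space X \<T> E"
    using T1 by (rule soft_T1_II_imp_space)
next
  fix x y assume "x \<in> X" "y \<in> X" "x \<noteq> y"
  \<comment> \<open>The least soft set containing \<open>z\<close> at every parameter, hence the
    best candidate for disjointness.\<close>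
  let ?C = "\<lambda>z. \<lambda>e\<in>E. {z}"
  have "?C z \<in> \<T>" if "z \<in> X" for z
    using that by (intro finite_soft_T1_II_discrete[OF assms]) (simp add: soft_sets_def)
  then have "?C x \<in> \<T>" "?C y \<in> \<T>"
    using \<open>x \<in> X\<close> \<open>y \<in> X\<close> by blast+
  moreover have "full_mem E x (?C x)" "full_mem E y (?C y)"
    by (simp_all add: full_mem_def)
  moreover have "soft_inter E (?C x) (?C y) = soft_null E"
    using \<open>x \<noteq> y\<close> by (simp add: soft_inter_def soft_null_def fun_eq_iff)
  ultimately show "\<exists>F\<in>\<T>. \<exists>G\<in>\<T>.
      full_mem E x F \<and> full_mem E y G \<and> soft_inter E F G = soft_null E"
    by blast
qed

theorem proposition3p5:
  fixes X :: "'x set" and E :: "'e set" and \<T> :: "('e, 'x) soft_set set"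
    and x y :: 'x and e\<^sub>1 e\<^sub>2 :: 'e
  assumes "X = {x, y}" and "x \<noteq> y"
    and "E = {e\<^sub>1, e\<^sub>2}" and "e\<^sub>1 \<noteq> e\<^sub>2"
    and "soft_T1_II X \<T> E"
  shows "soft_T2_I X \<T> E"
  using assms by (intro finite_soft_T1_II_imp_soft_T2_I) simp_all

end
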